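(* Let $d\ge 3$ and let $h,g$ be distinct $d$-uniform hypergraphs on the same vertex set with $\mathrm{Proj}_W(h)=\mathrm{Proj}_W(g)$. Then $d-1-\frac{1}{m(h)}\ge\frac d2-1\ge\frac{d-1}{d+1}$.
   Context: $\mathrm{Proj}_W(H)$ is the edge-weighted graph on the vertex set of $H$ where the weight of $\{i,j\}$ is the number of hyperedges of $H$ containing $\{i,j\}$. $m(H)=\max_{K\subseteq H} e(K)/v(K)$ over subhypergraphs $K$ of $H$, where $e,v$ count hyperedges and vertices. *)

theory Defs
  imports Complex_Main
begin

datatype 'a hypergraph = Hypergraph (verts: "'a set") (hedges: "'a set set")

definition hypergraph :: "'a hypergraph \<Rightarrow> bool" where
  "hypergraph H \<longleftrightarrow> finite (verts H) \<and> (\<forall>e \<in> hedges H. e \<subseteq> verts H)"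

definition uniform_hypergraph :: "nat \<Rightarrow> 'a hypergraph \<Rightarrow> bool" where
  "uniform_hypergraph d H \<longleftrightarrow> hypergraph H \<and> (\<forall>e \<in> hedges H. card e = d)"

definition subhypergraph :: "'a hypergraph \<Rightarrow> 'a hypergraph \<Rightarrow> bool" where
  "subhypergraph K H \<longleftrightarrow> hypergraph K \<and> verts K \<subseteq> verts H \<and> hedges K \<subseteq> hedges H"

datatype 'a weighted_graph = WeightedGraph (wverts: "'a set") (weight: "'a set \<Rightarrow> nat")

(* The weight function takes the dummy value 0 on sets that are not 2-subsets of the
   vertex set, so that equality of values of this type is equality of the weighted
   graphs.  A pair lying in no hyperedge has weight 0. *)
definition Proj_W :: "'a hypergraph \<Rightarrow> 'a weighted_graph" where
  "Proj_W H = WeightedGraph (verts H)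
     (\<lambda>p. if p \<subseteq> verts H \<and> card p = 2 then card {e \<in> hedges H. p \<subseteq> e} else 0)"

(* The ratio e(K)/v(K) only makes sense for K with at least one vertex. *)
definition max_density :: "'a hypergraph \<Rightarrow> real" where
  "max_density H =
     Max {real (card (hedges K)) / real (card (verts K)) |K. subhypergraph K H \<and> verts K \<noteq> {}}"

end

theory Submission
  imports Defs
begin

text \<open>
  Put \<open>A = hedges h - hedges g\<close> and \<open>B = hedges g - hedges h\<close>; every pair is contained in equally
  many members of \<open>A\<close> and of \<open>B\<close>. If a vertex \<open>v\<close> were in exactly one \<open>e \<in> A\<close>, then any \<open>f \<in> B\<close>
  through \<open>v\<close> would only contain pairs \<open>{v, u}\<close> with \<open>u \<in> e\<close>, hence \<open>f = e\<close>, which is absurd. So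
  every vertex covered by \<open>A\<close> has degree at least 2 in \<open>A\<close>, and double counting incidences shows
  that \<open>A\<close> has density at least \<open>2 / d\<close> on its support.
\<close>

lemma card_Diff_eq_if_card_eq:
  assumes "finite A" "finite B" "card A = card B"
  shows "card (A - B) = card (B - A)"
  using assms by (simp add: card_Diff_subset_Int Int_commute)

lemma finite_hedges:
  assumes "hypergraph H"
  shows "finite (hedges H)"
  using assms by (auto simp: hypergraph_def intro: finite_subset[of _ "Pow (verts H)"])

lemma card_hedges_eq_if_Proj_W_eq:
  assumes "Proj_W h = Proj_W g" "p \<subseteq> verts h" "card p = 2"
  shows "card {e \<in> hedges h. p \<subseteq> e} = card {e \<in> hedges g. p \<subseteq> e}"
proof -
  have "verts h = verts g"
    using assms(1) by (simp add: Proj_W_def)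
  moreover have "weight (Proj_W h) p = weight (Proj_W g) p"
    using assms(1) by simp
  ultimately show ?thesis using assms(2,3) by (simp add: Proj_W_def)
qed

text \<open>Hyperedges common to \<open>h\<close> and \<open>g\<close> contribute equally to both
  pair counts, so they cancel.\<close>

lemma card_hedges_Diff_eq_if_Proj_W_eq:
  assumes "hypergraph h" "hypergraph g" "Proj_W h = Proj_W g" "p \<subseteq> verts h" "card p = 2"
  shows "card {e \<in> hedges h - hedges g. p \<subseteq> e} = card {e \<in> hedges g - hedges h. p \<subseteq> e}"
proof -
  have "card ({e \<in> hedges h. p \<subseteq> e} - {e \<in> hedges g. p \<subseteq> e})
      = card ({e \<in> hedges g. p \<subseteq> e} - {e \<in> hedges h. p \<subseteq> e})"
    using assms finite_hedges[of h] finite_hedges[of g]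
    by (intro card_Diff_eq_if_card_eq card_hedges_eq_if_Proj_W_eq) auto
  moreover have "{e \<in> X. p \<subseteq> e} - {e \<in> Y. p \<subseteq> e} = {e \<in> X - Y. p \<subseteq> e}" for X Y
    by auto
  ultimately show ?thesis by simp
qed

text \<open>Carries the covering of a pair from one family to the other; it is applied in both
  directions between \<open>A\<close> and \<open>B\<close>.\<close>

lemma ex_superset_if_card_eq:
  assumes "finite A" "card {e \<in> A. p \<subseteq> e} = card {e \<in> B. p \<subseteq> e}" "e \<in> A" "p \<subseteq> e"
  shows "\<exists>f\<in>B. p \<subseteq> f"
proof -
  have "card {e \<in> A. p \<subseteq> e} \<noteq> 0"
    using assms(1,3,4) by auto
  then have "{e \<in> B. p \<subseteq> e} \<noteq> {}"
    using assms(2) by (metis card.empty)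
  then show ?thesis by blast
qed

lemma degree_ge_2_if_pair_degrees_eq:
  assumes fin: "finite A" "finite B" and disj: "A \<inter> B = {}"
    and card: "\<And>e. e \<in> A \<union> B \<Longrightarrow> card e = d" and d: "2 \<le> d"
    and pairs: "\<And>p. p \<subseteq> \<Union>(A \<union> B) \<Longrightarrow> card p = 2
      \<Longrightarrow> card {e \<in> A. p \<subseteq> e} = card {e \<in> B. p \<subseteq> e}"
    and v: "v \<in> \<Union>A"
  shows "2 \<le> card {e \<in> A. v \<in> e}"
proof (rule ccontr)
  assume contr: "\<not> 2 \<le> card {e \<in> A. v \<in> e}"
  obtain e where e: "e \<in> A" "v \<in> e" using v by blast
  have "card {e \<in> A. v \<in> e} \<noteq> 0" using fin(1) e by auto
  with contr have "card {e \<in> A. v \<in> e} = 1" by linarith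
  then obtain e' where singleton: "{e \<in> A. v \<in> e} = {e'}" by (rule card_1_singletonE)
  have unique: "x = e" if "x \<in> A" "v \<in> x" for x
  proof -
    have "x \<in> {e \<in> A. v \<in> e}" "e \<in> {e \<in> A. v \<in> e}" using that e by simp_all
    then show ?thesis unfolding singleton by simp
  qed
  have card_e: "card e = d" using card e by simp
  with d have fin_e: "finite e" by (simp add: card_ge_0_finite)
  \<comment> \<open>Since \<open>d\<close> is at least 2, \<open>e\<close> has a second vertex
    \<open>u\<close>. The pair \<open>{v, u}\<close> is what forces some \<open>f\<close> in
    \<open>B\<close> through \<open>v\<close>.\<close>
  have "\<not> e \<subseteq> {v}"
    using card_mono[of "{v}" e] card_e d by auto
  then obtain u where u: "u \<in> e" "u \<noteq> v" by blast
  have "\<exists>f\<in>B. {v, u} \<subseteq> f"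
    using e u fin(1) by (intro ex_superset_if_card_eq[of A _ B e] pairs) auto
  then obtain f where f: "f \<in> B" "v \<in> f" by blast
  have "f \<subseteq> e"
  proof
    fix w assume w: "w \<in> f"
    show "w \<in> e"
    proof (cases "w = v")
      case False
      \<comment> \<open>The pair \<open>{v, w}\<close> lies in \<open>f\<close>, hence in some
        member of \<open>A\<close>; as that member contains \<open>v\<close>, it can only be
        \<open>e\<close>.\<close>
      have "\<exists>e'\<in>A. {v, w} \<subseteq> e'"
        using f w False fin(2)
        by (intro ex_superset_if_card_eq[of B _ A f] pairs[symmetric]) auto
      then show ?thesis using unique by blast
    qed (use e in simp)
  qed
  then have "f = e"
    using card[of f] f card_e fin_e by (simp add: card_subset_eq)
  then show False using disj e f by blast
qed

text \<open>Double counting of the incidences between vertices and members of \<open>A\<close>: by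
  vertices there are at least \<open>k\<close> each, by members exactly \<open>d\<close>
  each.\<close>

lemma card_Union_le_if_degree_ge:
  assumes "finite A" "\<And>e. e \<in> A \<Longrightarrow> finite e" "\<And>e. e \<in> A \<Longrightarrow> card e = d"
    and "\<And>v. v \<in> \<Union>A \<Longrightarrow> k \<le> card {e \<in> A. v \<in> e}"
  shows "k * card (\<Union>A) \<le> d * card A"
proof -
  have "k * card (\<Union>A) \<le> (\<Sum>v\<in>\<Union>A. card {e \<in> A. v \<in> e})"
    using sum_mono[of "\<Union>A" "\<lambda>_. k"] assms(4) by (simp add: mult.commute)
  also have "\<dots> = (\<Sum>e\<in>A. card {v \<in> \<Union>A. v \<in> e})"
    using assms(1,2) by (intro sum_multicount_gen) auto
  also have "\<dots> = (\<Sum>e\<in>A. d)"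
  proof (rule sum.cong)
    fix e assume "e \<in> A"
    then have "{v \<in> \<Union>A. v \<in> e} = e" by blast
    then show "card {v \<in> \<Union>A. v \<in> e} = d" using assms(3) \<open>e \<in> A\<close> by simp
  qed simp
  finally show ?thesis by (simp add: mult.commute)
qed

text \<open>\<open>Max\<close> is an upper bound only on a finite set. The ratio depends only on the
  vertex set and the hyperedge set of \<open>K\<close>, which range over two finite power
  sets.\<close>

lemma density_le_max_density:
  assumes "hypergraph H" "subhypergraph K H" "verts K \<noteq> {}"
  shows "real (card (hedges K)) / real (card (verts K)) \<le> max_density H"
proof -
  let ?D = "{real (card (hedges K)) / real (card (verts K)) |K. subhypergraph K H \<and> verts K \<noteq> {}}"
  have "?D \<subseteq> (\<lambda>(V, E). real (card E) / real (card V)) ` (Pow (verts H) \<times> Pow (hedges H))"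
  proof
    fix x assume "x \<in> ?D"
    then obtain K where K: "x = real (card (hedges K)) / real (card (verts K))" "subhypergraph K H"
      by blast
    then show "x \<in> (\<lambda>(V, E). real (card E) / real (card V)) ` (Pow (verts H) \<times> Pow (hedges H))"
      by (intro image_eqI[of _ _ "(verts K, hedges K)"]) (auto simp: subhypergraph_def)
  qed
  moreover have "finite (Pow (verts H) \<times> Pow (hedges H))"
    using assms(1) finite_hedges by (auto simp: hypergraph_def)
  ultimately have "finite ?D"
    using finite_surj by blast
  then show ?thesis
    unfolding max_density_def using assms by (intro Max_ge) auto
qed

lemma max_density_ge_if_Proj_W_eq:
  assumes d: "2 \<le> d" and h: "uniform_hypergraph d h" and g: "uniform_hypergraph d g"
    and "h \<noteq> g" and proj: "Proj_W h = Proj_W g"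
  shows "2 / real d \<le> max_density h"
proof -
  define A where "A = hedges h - hedges g"
  define B where "B = hedges g - hedges h"
  have hyp: "hypergraph h" "hypergraph g"
    using h g by (simp_all add: uniform_hypergraph_def)
  have verts: "verts h = verts g"
    using proj by (simp add: Proj_W_def)
  have fin: "finite A" "finite B"
    using hyp finite_hedges by (auto simp: A_def B_def)
  have sub: "\<Union>(A \<union> B) \<subseteq> verts h"
    using hyp verts by (auto simp: A_def B_def hypergraph_def)
  have card: "card e = d" if "e \<in> A \<union> B" for e
    using that h g by (auto simp: A_def B_def uniform_hypergraph_def)
  have pairs: "card {e \<in> A. p \<subseteq> e} = card {e \<in> B. p \<subseteq> e}"
    if "p \<subseteq> \<Union>(A \<union> B)" "card p = 2" for p
    unfolding A_def B_def using card_hedges_Diff_eq_if_Proj_W_eq hyp proj that sub by blast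
  have "finite (verts h)" using hyp by (simp add: hypergraph_def)
  with sub have finU: "finite (\<Union>A)" by (auto intro: finite_subset)

  \<comment> \<open>If \<open>A\<close> were empty, \<open>B\<close> would not be, and a pair inside
    a member of \<open>B\<close> would have to be covered by \<open>A\<close>.\<close>
  have "A \<noteq> {}"
  proof
    assume "A = {}"
    moreover have "hedges h \<noteq> hedges g"
      using verts \<open>h \<noteq> g\<close> by (metis hypergraph.expand)
    ultimately obtain f where f: "f \<in> B" by (auto simp: A_def B_def)
    obtain p where p: "p \<subseteq> f" "card p = 2"
      using obtain_subset_with_card_n[of 2 f] card[of f] f d by auto
    have "\<exists>e\<in>A. p \<subseteq> e"
      using f p fin(2) by (intro ex_superset_if_card_eq[of B _ A f] pairs[symmetric]) auto
    with \<open>A = {}\<close> show False by blast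
  qed
  then have ne: "\<Union>A \<noteq> {}"
    using card d by (metis UnCI Union_empty_conv all_not_in_conv card.empty not_numeral_le_zero)

  have "2 \<le> card {e \<in> A. v \<in> e}" if "v \<in> \<Union>A" for v
    using fin card d pairs that by (intro degree_ge_2_if_pair_degrees_eq[of A B d]) (auto simp: A_def B_def)
  then have "2 * card (\<Union>A) \<le> d * card A"
    using fin finU card by (intro card_Union_le_if_degree_ge) (auto intro: finite_subset)
  then have "2 * real (card (\<Union>A)) \<le> real d * real (card A)"
    by (metis of_nat_le_iff of_nat_mult of_nat_numeral)
  moreover have "card (\<Union>A) > 0"
    using ne finU by (simp add: card_gt_0_iff)
  ultimately have "2 / real d \<le> real (card A) / real (card (\<Union>A))"
    using d by (simp add: field_simps)
  \<comment> \<open>The dense subhypergraph is \<open>A\<close> on its own support, without the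
    other vertices of \<open>h\<close>.\<close>
  also have "\<dots> \<le> max_density h"
    using density_le_max_density[of h "Hypergraph (\<Union>A) A"] hyp ne finU sub
    by (auto simp: subhypergraph_def hypergraph_def A_def)
  finally show ?thesis .
qed

theorem theorem38:
  fixes d :: nat and h g :: "'a hypergraph"
  assumes "d \<ge> 3"
    and "uniform_hypergraph d h" and "uniform_hypergraph d g"
    and "verts h = verts g"
    and "h \<noteq> g"
    and "Proj_W h = Proj_W g"
  shows "real d - 1 - 1 / max_density h \<ge> real d / 2 - 1
    \<and> real d / 2 - 1 \<ge> (real d - 1) / (real d + 1)"
proof
  have "2 / real d \<le> max_density h"
    using assms by (intro max_density_ge_if_Proj_W_eq[of d h g]) auto
  moreover have "0 < 2 / real d" using assms(1) by simp
  \<comment> \<open>The right-hand side is \<open>d / 2\<close>, and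
    \<open>d - 1 - d / 2 = d / 2 - 1\<close>.\<close>
  ultimately have "1 / max_density h \<le> 1 / (2 / real d)"
    by (intro frac_le) auto
  then show "real d - 1 - 1 / max_density h \<ge> real d / 2 - 1"
    by simp
next
  \<comment> \<open>Clearing denominators turns the goal into
    \<open>(d - 2) * (d + 1) \<ge> 2 * (d - 1)\<close>, that is
    \<open>d * d \<ge> 3 * d\<close>.\<close>
  have "real d * 3 \<le> real d * real d"
    using assms(1) by (intro mult_left_mono) auto
  then show "real d / 2 - 1 \<ge> (real d - 1) / (real d + 1)"
    by (simp add: field_simps)
qed

end
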